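(* Let $a,b,c,\alpha,\beta,\gamma$ be integers with $0\le\alpha<a$, $0\le\beta<b$, $0\le\gamma<c$ and at most one of $\alpha,\beta,\gamma$ zero. Suppose $a+b+c+\alpha+\beta+\gamma\equiv 0\pmod 3$, put $s=\frac13(a+b+c+\alpha+\beta+\gamma)-2$, $A=s+2-a$, $B=s+2-b$, $C=s+2-c$, $M=s+2-(\alpha+\beta+\gamma)$, and assume $0\le M$, $0\le A\le\beta+\gamma$, $0\le B\le\alpha+\gamma$, $0\le C\le\alpha+\beta$. If $c=\frac12(a+b+\alpha+\beta+\gamma)$, then $C=0$ and $$\det N_{a,b,c,\alpha,\beta,\gamma}=\operatorname{Mac}(M,A-\beta,B-\alpha).$$ Thus, for an infinite field $K$, the algebra $K[x,y,z]/(x^a,y^b,z^c,x^\alpha y^\beta z^\gamma)$ has the weak Lefschetz property if the characteristic of $K$ is zero or at least $A+B+M-\alpha-\beta=c-\alpha-\beta$.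
   Context: For non-negative integers, $\operatorname{Mac}(p,q,r):=\dfrac{\mathcal H(p)\mathcal H(q)\mathcal H(r)\mathcal H(p+q+r)}{\mathcal H(p+q)\mathcal H(p+r)\mathcal H(q+r)}$, where $\mathcal H(n):=\prod_{i=0}^{n-1}i!$ is the hyperfactorial. $N_{a,b,c,\alpha,\beta,\gamma}$ is the $(C+M)\times(C+M)$ integer matrix with $(i,j)$ entry $\binom{c}{A+j-i}$ if $1\le i\le C$ and $\binom{\gamma}{A+C-\beta+j-i}$ if $C+1\le i\le C+M$, where $\binom nk=0$ if $k<0$ or $k>n$ (determinant of the empty matrix is $1$). An artinian standard graded $K$-algebra $Q$ has the weak Lefschetz property if there is a linear form $\ell\in[Q]_1$ such that for all integers $d$ the map $\times\ell:[Q]_d\to[Q]_{d+1}$ is injective or surjective. *)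

theory Defs
  imports
    "HOL-Library.Poly_Mapping"
    "HOL-Algebra.QuotRing"
    "HOL-Algebra.Algebraic_Closure_Type"
    "Jordan_Normal_Form.Determinant"
begin

definition hyperfact :: "nat \<Rightarrow> nat" where
  "hyperfact n = (\<Prod>i<n. fact i)"

text \<open>The quotient defining Mac is taken in the rationals, so that no integrality is presupposed.\<close>

definition Mac :: "nat \<Rightarrow> nat \<Rightarrow> nat \<Rightarrow> rat" where
  "Mac p q r =
     of_nat (hyperfact p * hyperfact q * hyperfact r * hyperfact (p + q + r)) /
     of_nat (hyperfact (p + q) * hyperfact (p + r) * hyperfact (q + r))"

definition binom_int :: "int \<Rightarrow> int \<Rightarrow> int" where
  "binom_int n k = (if k < 0 \<or> k > n then 0 else int (nat n choose nat k))"

text \<open>Library matrices are indexed from 0; \<open>i\<close> and \<open>j\<close> below are the indices counted from 1.\<close>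

definition N_mat :: "int \<Rightarrow> int \<Rightarrow> int \<Rightarrow> int \<Rightarrow> int \<Rightarrow> int \<Rightarrow> int mat" where
  "N_mat a b c \<alpha> \<beta> \<gamma> =
     (let s = (a + b + c + \<alpha> + \<beta> + \<gamma>) div 3 - 2;
          A = s + 2 - a;
          C = s + 2 - c;
          M = s + 2 - (\<alpha> + \<beta> + \<gamma>)
      in mat (nat (C + M)) (nat (C + M))
           (\<lambda>(i0, j0). let i = int i0 + 1; j = int j0 + 1 in
              if i \<le> C then binom_int c (A + j - i)
              else binom_int \<gamma> (A + C - \<beta> + j - i)))"

text \<open>A polynomial maps finitely many monomials (exponent vectors \<open>'v \<Rightarrow>\<^sub>0 nat\<close>) to
  nonzero coefficients; the ring structure is the convolution product of \<open>Poly_Mapping\<close>.\<close>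

type_synonym ('v, 'k) mpoly = "('v \<Rightarrow>\<^sub>0 nat) \<Rightarrow>\<^sub>0 'k"

datatype xyz = Vx | Vy | Vz

definition var :: "'v \<Rightarrow> ('v, 'k::comm_ring_1) mpoly" where
  "var v = Poly_Mapping.single (Poly_Mapping.single v 1) 1"

definition mon_deg :: "('v \<Rightarrow>\<^sub>0 nat) \<Rightarrow> nat" where
  "mon_deg m = (\<Sum>v\<in>Poly_Mapping.keys m. Poly_Mapping.lookup m v)"

text \<open>Degrees are integers: the component of negative degree is \<open>{0}\<close>.\<close>

definition poly_component :: "int \<Rightarrow> ('v, 'k::comm_ring_1) mpoly set" where
  "poly_component d = {p. \<forall>m\<in>Poly_Mapping.keys p. int (mon_deg m) = d}"

definition mpoly_ring :: "('v, 'k::comm_ring_1) mpoly ring" where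
  "mpoly_ring = ring_of_type_algebra"

definition quot_component ::
    "('v, 'k::comm_ring_1) mpoly set \<Rightarrow> int \<Rightarrow> ('v, 'k) mpoly set set" where
  "quot_component I d = (\<lambda>p. I +>\<^bsub>mpoly_ring\<^esub> p) ` poly_component d"

text \<open>\<open>gr d\<close> is the homogeneous component of degree \<open>d\<close> of \<open>Q\<close>.
  The notion is meant for artinian standard graded algebras over a field.\<close>

definition weak_Lefschetz :: "('q, 'm) ring_scheme \<Rightarrow> (int \<Rightarrow> 'q set) \<Rightarrow> bool" where
  "weak_Lefschetz Q gr \<longleftrightarrow>
     (\<exists>l\<in>gr 1. \<forall>d.
        inj_on (\<lambda>q. l \<otimes>\<^bsub>Q\<^esub> q) (gr d) \<or> (\<lambda>q. l \<otimes>\<^bsub>Q\<^esub> q) ` gr d = gr (d + 1))"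

definition monomial_ideal ::
    "nat \<Rightarrow> nat \<Rightarrow> nat \<Rightarrow> nat \<Rightarrow> nat \<Rightarrow> nat \<Rightarrow> (xyz, 'k::field) mpoly set" where
  "monomial_ideal a b c \<alpha> \<beta> \<gamma> =
     Idl\<^bsub>mpoly_ring\<^esub> {var Vx ^ a, var Vy ^ b, var Vz ^ c, var Vx ^ \<alpha> * var Vy ^ \<beta> * var Vz ^ \<gamma>}"

end

theory Submission
  imports Defs
begin

text \<open>
  The hypothesis on \<open>c\<close> forces \<open>c = s + 2\<close>, so \<open>C = 0\<close> and only the second block of the matrix is
  present. With \<open>p = A - \<beta>\<close> and \<open>q = B - \<alpha>\<close> one has \<open>\<gamma> = p + q\<close>, \<open>a = \<alpha> + q + M\<close>, \<open>b = \<beta> + p + M\<close>,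
  \<open>c = \<alpha> + \<beta> + \<gamma> + M\<close>, and the matrix is the \<open>M \<times> M\<close> Toeplitz matrix with entries
  \<open>(p + q choose q + i - j)\<close>, with indices counted from \<open>0\<close>.

  \<^bold>\<open>Determinant.\<close> Multiplying by the unitriangular Pascal matrix turns the entries into
  \<open>(p + q + j choose q + i)\<close>, by Vandermonde's convolution. Up to factorials depending on only one
  of the indices these are the numbers \<open>(p + j choose i)\<close>, and Vandermonde's convolution factors
  that matrix into two unitriangular ones. What remains is a product of factorials, which is
  \<open>Mac M p q\<close> (\<open>det_binom_toeplitz\<close>). All factorials in the numerator are of numbers below
  \<open>M + p + q = c - \<alpha> - \<beta>\<close>, so the determinant does not vanish in a field whose characteristic is
  zero or at least this number (\<open>det_binom_toeplitz_nonzero\<close>).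

  \<^bold>\<open>Lefschetz property.\<close> The form \<open>\<ell> = z - x - y\<close> is a Lefschetz element. Modulo \<open>\<ell>\<close> the variable
  \<open>z\<close> becomes \<open>x + y\<close>, and the generator \<open>x^\<alpha> y^\<beta> z^\<gamma>\<close> becomes \<open>x^\<alpha> y^\<beta> (x + y)^\<gamma>\<close>. Multiplication by
  the latter sends binary forms of degree \<open>M - 1\<close> to binary forms of degree \<open>c - 1\<close> modulo
  \<open>(x^a, y^b)\<close>; both spaces have dimension \<open>M\<close>, and in the monomial bases the map is the Toeplitz
  matrix above (\<open>lookup_xy_generator_mult\<close>). As the determinant is nonzero, the map is bijective.

  Surjectivity says that every binary form of degree \<open>c - 1\<close> lies in the ideal modulo \<open>\<ell>\<close>, hence
  every form of degree at least \<open>c - 1\<close> does, and \<open>\<times>\<ell>\<close> is surjective onto the components of these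
  degrees (\<open>ell_surjective\<close>). Injectivity yields that \<open>\<times>\<ell>\<close> is injective into the
  components of degree below \<open>c\<close> (\<open>ell_injective\<close>): in such degrees \<open>z^c\<close> is absent, so a relation
  \<open>\<ell> f \<in> I\<close> reads \<open>\<ell> f = x^\<alpha> y^\<beta> z^\<gamma> g\<close> modulo \<open>(x^a, y^b)\<close>; injectivity forces \<open>g\<close> to be divisible
  by \<open>\<ell>\<close>, and \<open>\<ell>\<close>, being monic in \<open>z\<close>, can be cancelled modulo \<open>(x^a, y^b)\<close>.
  The two ranges of degrees cover everything.
\<close>

section \<open>A Toeplitz determinant of binomial coefficients\<close>

definition binom_toeplitz :: "nat \<Rightarrow> nat \<Rightarrow> nat \<Rightarrow> 'r::comm_ring_1 mat" where
  "binom_toeplitz M n q =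
     mat M M (\<lambda>(i, j). if j \<le> q + i then of_nat (n choose (q + i - j)) else 0)"

definition pascal_mat :: "nat \<Rightarrow> 'r::comm_ring_1 mat" where
  "pascal_mat M = mat M M (\<lambda>(i, j). of_nat (j choose i))"

lemma binom_toeplitz_carrier [simp]: "binom_toeplitz M n q \<in> carrier_mat M M"
  by (simp add: binom_toeplitz_def)

lemma pascal_mat_carrier [simp]: "pascal_mat M \<in> carrier_mat M M"
  by (simp add: pascal_mat_def)

lemma det_pascal_mat: "det (pascal_mat M :: int mat) = 1"
proof -
  have "upper_triangular (pascal_mat M :: int mat)"
    by (auto simp: pascal_mat_def binomial_eq_0)
  then have "det (pascal_mat M :: int mat) = prod_list (diag_mat (pascal_mat M))"
    by (rule det_upper_triangular[OF _ pascal_mat_carrier])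
  also have "diag_mat (pascal_mat M :: int mat) = replicate M 1"
    by (intro nth_equalityI) (auto simp: diag_mat_def pascal_mat_def)
  finally show ?thesis by simp
qed

lemma det_binom_toeplitz_0: "det (binom_toeplitz M n 0 :: int mat) = 1"
proof -
  have "det (binom_toeplitz M n 0 :: int mat) = prod_list (diag_mat (binom_toeplitz M n 0))"
    by (rule det_lower_triangular[of M]) (auto simp: binom_toeplitz_def)
  also have "diag_mat (binom_toeplitz M n 0 :: int mat) = replicate M 1"
    by (intro nth_equalityI) (auto simp: diag_mat_def binom_toeplitz_def)
  finally show ?thesis by simp
qed

text \<open>
  The convolution stays complete after truncation at \<open>M\<close>, because the omitted terms contain
  \<open>(j choose k)\<close> with \<open>k > j\<close>.
\<close>

lemma vandermonde_truncated:
  assumes "j < M"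
  shows "(\<Sum>k<M. (if k \<le> r then n choose (r - k) else 0) * (j choose k)) = (n + j) choose r"
proof -
  have "(\<Sum>k<M. (if k \<le> r then n choose (r - k) else 0) * (j choose k)) =
        (\<Sum>k\<le>r. (j choose k) * (n choose (r - k)))"
  proof (rule sum.mono_neutral_cong)
    fix k assume "k \<in> {..r} - {..<M}"
    then have "j < k" using assms by auto
    then show "(j choose k) * (n choose (r - k)) = 0" by (simp add: binomial_eq_0)
  qed (auto simp: mult.commute)
  also have "\<dots> = (n + j) choose r" by (simp add: vandermonde add.commute)
  finally show ?thesis .
qed

text \<open>
  One instance (\<open>n = p + q\<close>) transforms the matrix of interest without changing its determinant;
  another (\<open>n = p\<close>, \<open>q = 0\<close>) is the LU factorisation of \<open>(p + j choose i)\<close>.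
\<close>

lemma binom_toeplitz_mult_pascal:
  "binom_toeplitz M n q * pascal_mat M = mat M M (\<lambda>(i, j). of_nat ((n + j) choose (q + i)))"
    (is "?L = ?R")
proof (rule eq_matI)
  fix i j assume "i < dim_row ?R" "j < dim_col ?R"
  then have ij: "i < M" "j < M" by auto
  have "?L $$ (i, j) =
      of_nat (\<Sum>k<M. (if k \<le> q + i then n choose (q + i - k) else 0) * (j choose k))"
    using ij by (auto simp: binom_toeplitz_def pascal_mat_def scalar_prod_def atLeast0LessThan
        intro!: sum.cong)
  then show "?L $$ (i, j) = ?R $$ (i, j)"
    using ij by (simp only: vandermonde_truncated[OF ij(2)]) simp
qed (auto simp: binom_toeplitz_def pascal_mat_def)

lemma det_mat_scale:
  fixes h :: "nat \<Rightarrow> nat \<Rightarrow> 'r::comm_ring_1"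
  shows "det (mat n n (\<lambda>(i, j). f i * h i j * g j)) =
    (\<Prod>i<n. f i) * det (mat n n (\<lambda>(i, j). h i j)) * (\<Prod>j<n. g j)"
proof -
  have perm: "(\<Prod>i<n. g (\<pi> i)) = (\<Prod>i<n. g i)" if "\<pi> permutes {0..<n}" for \<pi>
    using prod.permute[OF that, of g] by (simp add: comp_def atLeast0LessThan)
  show ?thesis
    unfolding det_def'[of "mat n n _", OF mat_carrier] sum_distrib_left sum_distrib_right
  proof (rule sum.cong[OF refl], clarify)
    fix \<pi> assume \<pi>: "\<pi> permutes {0..<n}"
    have lt: "\<pi> i < n" if "i < n" for i
      using permutes_in_image[OF \<pi>, of i] that by simp
    have "(\<Prod>i=0..<n. mat n n (\<lambda>(i, j). f i * h i j * g j) $$ (i, \<pi> i)) =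
      (\<Prod>i<n. f i * h i (\<pi> i) * g (\<pi> i))"
      by (simp add: lt atLeast0LessThan)
    also have "\<dots> = (\<Prod>i<n. f i) * (\<Prod>i<n. h i (\<pi> i)) * (\<Prod>j<n. g j)"
      by (simp add: prod.distrib perm[OF \<pi>])
    also have "(\<Prod>i<n. h i (\<pi> i)) = (\<Prod>i=0..<n. mat n n (\<lambda>(i, j). h i j) $$ (i, \<pi> i))"
      by (simp add: lt atLeast0LessThan)
    finally show "signof \<pi> * (\<Prod>i=0..<n. mat n n (\<lambda>(i, j). f i * h i j * g j) $$ (i, \<pi> i)) =
      prod f {..<n} * (signof \<pi> * (\<Prod>i=0..<n. mat n n (\<lambda>(i, j). h i j) $$ (i, \<pi> i))) * prod g {..<n}"
      by (simp add: mult_ac)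
  qed
qed

lemma hyperfact_add: "hyperfact (m + n) = hyperfact m * (\<Prod>i<n. fact (m + i))"
  by (induction n) (simp_all add: hyperfact_def mult_ac)

lemma hyperfact_pos: "hyperfact n > 0"
  by (simp add: hyperfact_def prod_pos)

text \<open>
  For \<open>i \<le> p + j\<close> both sides are \<open>(p + j)! (p + q + j)! / (p + j - i)!\<close>. The factors in front of
  the binomial coefficients depend only on the row or only on the column.
\<close>

lemma binomial_fact_exchange:
  "fact (q + i) * ((p + q + j) choose (q + i)) * fact (p + j) =
   fact i * ((p + j) choose i) * (fact (p + q + j) :: nat)"
proof (cases "i \<le> p + j")
  case True
  have pq: "fact (p + q + j) = (fact (p + j - i) * (fact (q + i) * ((p + q + j) choose (q + i))) :: nat)"
    using binomial_fact_lemma[of "q + i" "p + q + j"] True by (simp add: ac_simps)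
  have p: "fact (p + j) = (fact (p + j - i) * (fact i * ((p + j) choose i)) :: nat)"
    using binomial_fact_lemma[of i "p + j"] True by (simp add: ac_simps)
  show ?thesis
    by (subst pq, subst p) (simp only: ac_simps)
qed (simp add: binomial_eq_0)

lemma det_binom_toeplitz_factorials:
  "(\<Prod>i<M. fact (q + i)) * det (binom_toeplitz M (p + q) q) * (\<Prod>j<M. fact (p + j)) =
   (\<Prod>i<M. fact i) * (\<Prod>j<M. fact (p + q + j) :: int)"
proof -
  let ?T = "binom_toeplitz M (p + q) q :: int mat"
  have 1: "det ?T = det (mat M M (\<lambda>(i, j). int ((p + q + j) choose (q + i))))"
    using det_mult[of ?T M "pascal_mat M"]
    by (simp add: det_pascal_mat binom_toeplitz_mult_pascal)
  have 2: "det (mat M M (\<lambda>(i, j). int ((p + j) choose i))) = 1"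
    using det_mult[of "binom_toeplitz M p 0 :: int mat" M "pascal_mat M"]
    by (simp add: det_pascal_mat binom_toeplitz_mult_pascal det_binom_toeplitz_0)
  have "mat M M (\<lambda>(i, j). fact (q + i) * int ((p + q + j) choose (q + i)) * fact (p + j)) =
    mat M M (\<lambda>(i, j). fact i * int ((p + j) choose i) * fact (p + q + j))"
    using binomial_fact_exchange[of q _ p _, THEN arg_cong[where f = int]]
    by (intro cong_mat) auto
  then show ?thesis
    unfolding 1 det_mat_scale[symmetric] by (simp only: det_mat_scale 2 mult_1_right)
qed

lemma det_binom_toeplitz:
  "det (binom_toeplitz M (p + q) q) *
     int (hyperfact (M + p) * hyperfact (M + q) * hyperfact (p + q)) =
   int (hyperfact M * hyperfact p * hyperfact q * hyperfact (M + p + q))"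
proof -
  have h: "int (hyperfact (M + m)) = int (hyperfact m) * (\<Prod>i<M. fact (m + i))" for m
    by (simp add: add.commute[of M] hyperfact_add)
  have M: "int (hyperfact M) = (\<Prod>i<M. fact i)" by (simp add: hyperfact_def)
  have regroup: "d * (hp * P * (hq * Q) * h) = hp * hq * h * (Q * d * P)"
    for d hp P hq Q h :: int by (simp only: ac_simps)
  show ?thesis
    unfolding of_nat_mult h add.assoc[of M] M regroup det_binom_toeplitz_factorials
    by (simp only: ac_simps)
qed

text \<open>
  Only factorials of numbers below \<open>n\<close> occur, and a prime that is at least \<open>n\<close> divides none of them.
\<close>

lemma of_nat_hyperfact_nonzero:
  assumes "CHAR('k::field) = 0 \<or> n \<le> CHAR('k)"
  shows "(of_nat (hyperfact n) :: 'k) \<noteq> 0"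
proof (cases "CHAR('k) = 0")
  case True
  then show ?thesis using hyperfact_pos[of n] by (auto simp: of_nat_eq_0_iff_char_dvd)
next
  case False
  then have p: "prime CHAR('k)" using prime_CHAR_semidom[where 'a = 'k] by simp
  have "\<not> CHAR('k) dvd fact i" if "i < n" for i
    using prime_dvd_fact_iff[OF p, of i] that assms False by auto
  then have "\<not> CHAR('k) dvd hyperfact n"
    unfolding hyperfact_def using p by (auto simp: prime_dvd_prod_iff)
  then show ?thesis by (simp add: of_nat_eq_0_iff_char_dvd)
qed

lemma of_int_binom_toeplitz:
  "map_mat of_int (binom_toeplitz M n q) = (binom_toeplitz M n q :: 'r::comm_ring_1 mat)"
  by (rule eq_matI) (auto simp: binom_toeplitz_def)

lemma det_binom_toeplitz_nonzero:
  assumes "CHAR('k::field) = 0 \<or> M + p + q \<le> CHAR('k)"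
  shows "det (binom_toeplitz M (p + q) q :: 'k mat) \<noteq> 0"
proof
  assume "det (binom_toeplitz M (p + q) q :: 'k mat) = 0"
  then have "of_int (det (binom_toeplitz M (p + q) q :: int mat)) = (0::'k)"
    by (metis of_int_binom_toeplitz of_int_hom.hom_det)
  then have "of_int (int (hyperfact M * hyperfact p * hyperfact q * hyperfact (M + p + q))) = (0::'k)"
    unfolding det_binom_toeplitz[symmetric] by simp
  then have "of_nat (hyperfact M) * of_nat (hyperfact p) * of_nat (hyperfact q)
      * of_nat (hyperfact (M + p + q)) = (0::'k)"
    by simp
  moreover have "(of_nat (hyperfact n) :: 'k) \<noteq> 0" if "n \<le> M + p + q" for n
    using of_nat_hyperfact_nonzero[of n, where 'k = 'k] assms that by fastforce
  ultimately show False by simp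
qed

section \<open>Polynomials with prescribed exponents\<close>

text \<open>
  Monomial ideals, homogeneous components and the polynomials not involving \<open>z\<close> are all of this
  form, and a sum of members can be treated one monomial at a time (\<open>supported_induct\<close>).
\<close>

definition supported :: "('v \<Rightarrow>\<^sub>0 nat) set \<Rightarrow> ('v, 'k::comm_ring_1) mpoly set" where
  "supported U = {p. Poly_Mapping.keys p \<subseteq> U}"

lemma supportedI: "(\<And>m. m \<notin> U \<Longrightarrow> Poly_Mapping.lookup p m = 0) \<Longrightarrow> p \<in> supported U"
  by (auto simp: supported_def in_keys_iff)

lemma supportedD: "p \<in> supported U \<Longrightarrow> m \<notin> U \<Longrightarrow> Poly_Mapping.lookup p m = 0"
  by (auto simp: supported_def in_keys_iff)

lemma zero_in_supported [simp]: "0 \<in> supported U"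
  by (simp add: supported_def)

lemma supported_add: "p \<in> supported U \<Longrightarrow> q \<in> supported U \<Longrightarrow> p + q \<in> supported U"
  using keys_add[of p q] by (auto simp: supported_def)

lemma supported_uminus: "p \<in> supported U \<Longrightarrow> - p \<in> supported U"
  by (simp add: supported_def)

lemma supported_diff: "p \<in> supported U \<Longrightarrow> q \<in> supported U \<Longrightarrow> p - q \<in> supported U"
  using supported_add[of p U "- q"] by (simp add: supported_uminus)

lemma supported_sum: "(\<And>i. i \<in> S \<Longrightarrow> f i \<in> supported U) \<Longrightarrow> sum f S \<in> supported U"
  by (induction S rule: infinite_finite_induct) (auto intro: supported_add)

lemma supported_single: "m \<in> U \<Longrightarrow> Poly_Mapping.single m k \<in> supported U"
  by (simp add: supported_def)

lemma supported_mono: "p \<in> supported U \<Longrightarrow> U \<subseteq> V \<Longrightarrow> p \<in> supported V"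
  by (auto simp: supported_def)

lemma supported_mult:
  assumes "p \<in> supported U" "q \<in> supported V" "\<And>m n. m \<in> U \<Longrightarrow> n \<in> V \<Longrightarrow> m + n \<in> W"
  shows "p * q \<in> supported W"
  using keys_mult[of p q] assms by (fastforce simp: supported_def)

lemma supported_up_mult:
  fixes U :: "('v \<Rightarrow>\<^sub>0 nat) set"
  assumes "p \<in> supported U" "\<And>m n. m \<in> U \<Longrightarrow> n + m \<in> U"
  shows "q * p \<in> supported U"
  by (rule supported_mult[of _ UNIV _ U]) (use assms in \<open>auto simp: supported_def\<close>)

lemma monomial_sum:
  fixes p :: "'a \<Rightarrow>\<^sub>0 'b::comm_monoid_add"
  shows "(\<Sum>m\<in>Poly_Mapping.keys p. Poly_Mapping.single m (Poly_Mapping.lookup p m)) = p"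
  by (rule poly_mapping_eqI)
     (auto simp: lookup_sum lookup_single when_def in_keys_iff sum.delta)

lemma supported_induct [consumes 1, case_names zero single add]:
  assumes "p \<in> supported U" "P 0" "\<And>m k. m \<in> U \<Longrightarrow> P (Poly_Mapping.single m k)"
    "\<And>p q. P p \<Longrightarrow> P q \<Longrightarrow> P (p + q)"
  shows "P p"
proof -
  have "P (\<Sum>m\<in>K. Poly_Mapping.single m (Poly_Mapping.lookup p m))" if "K \<subseteq> U" for K
    using that by (induction K rule: infinite_finite_induct) (auto intro: assms)
  from this[of "Poly_Mapping.keys p"] show ?thesis
    using assms(1) by (simp add: monomial_sum supported_def)
qed

lemma lookup_single_mult_add:
  fixes t m :: "'v \<Rightarrow>\<^sub>0 nat" and p :: "('v, 'k::comm_ring_1) mpoly"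
  shows "Poly_Mapping.lookup (Poly_Mapping.single t k * p) (t + m) = k * Poly_Mapping.lookup p m"
proof -
  have "p \<in> supported UNIV" by (simp add: supported_def)
  then show ?thesis
    by (induction p rule: supported_induct)
       (auto simp: mult_single lookup_single lookup_add distrib_left when_def)
qed

lemma lookup_single_mult_not:
  fixes t m :: "'v \<Rightarrow>\<^sub>0 nat" and p :: "('v, 'k::comm_ring_1) mpoly"
  assumes "\<And>n. m \<noteq> t + n"
  shows "Poly_Mapping.lookup (Poly_Mapping.single t k * p) m = 0"
proof -
  have "p \<in> supported UNIV" by (simp add: supported_def)
  then show ?thesis
    by (induction p rule: supported_induct)
       (use assms in \<open>auto simp: mult_single lookup_single lookup_add distrib_left when_def\<close>)
qed

section \<open>Monomial ideals and the weak Lefschetz property of their quotients\<close>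

lemma mpoly_ring_simps [simp]:
  "carrier mpoly_ring = UNIV" "\<one>\<^bsub>mpoly_ring\<^esub> = 1" "\<zero>\<^bsub>mpoly_ring\<^esub> = 0"
  "p \<otimes>\<^bsub>mpoly_ring\<^esub> q = p * q" "p \<oplus>\<^bsub>mpoly_ring\<^esub> q = p + q"
  by (simp_all add: mpoly_ring_def ring_of_type_algebra_def)

lemma cring_mpoly_ring: "cring (mpoly_ring :: ('v, 'k::comm_ring_1) mpoly ring)"
  unfolding mpoly_ring_def by (rule cring_from_type_algebra)

lemma ring_mpoly_ring: "ring (mpoly_ring :: ('v, 'k::comm_ring_1) mpoly ring)"
  using cring_mpoly_ring by (rule cring.axioms)

lemma mpoly_ring_a_inv [simp]:
  "\<ominus>\<^bsub>mpoly_ring\<^esub> (p :: ('v, 'k::comm_ring_1) mpoly) = - p"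
proof -
  interpret ring "mpoly_ring :: ('v, 'k) mpoly ring" by (rule ring_mpoly_ring)
  show ?thesis using minus_equality[of "- p" p] by simp
qed

lemma ideal_supported:
  fixes U :: "('v \<Rightarrow>\<^sub>0 nat) set"
  assumes "\<And>m n. m \<in> U \<Longrightarrow> n + m \<in> U"
  shows "ideal (supported U) (mpoly_ring :: ('v, 'k::comm_ring_1) mpoly ring)"
proof -
  interpret ring "mpoly_ring :: ('v, 'k) mpoly ring" by (rule ring_mpoly_ring)
  have mult: "q * p \<in> supported U" if "p \<in> supported U" for p q :: "('v, 'k) mpoly"
    using that assms by (rule supported_up_mult)
  show ?thesis
  proof (rule idealI)
    show "subgroup (supported U) (add_monoid (mpoly_ring :: ('v, 'k) mpoly ring))"
      by (rule add.subgroupI)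
         (auto intro: supported_add supported_uminus zero_in_supported
               simp del: zero_in_supported simp flip: a_inv_def)
  qed (use mult in \<open>auto simp: mult.commute ring_mpoly_ring\<close>)
qed

lemma genideal_monomials:
  fixes G :: "('v \<Rightarrow>\<^sub>0 nat) set"
  shows "Idl\<^bsub>mpoly_ring\<^esub> ((\<lambda>g. Poly_Mapping.single g (1::'k::comm_ring_1)) ` G) =
    supported {n + g |n g. g \<in> G}" (is "Idl\<^bsub>_\<^esub> ?S = supported ?U")
proof -
  interpret ring "mpoly_ring :: ('v, 'k) mpoly ring" by (rule ring_mpoly_ring)
  interpret I: ideal "Idl\<^bsub>mpoly_ring\<^esub> ?S" "mpoly_ring :: ('v, 'k) mpoly ring"
    by (rule genideal_ideal) simp
  show ?thesis
  proof
    show "Idl\<^bsub>mpoly_ring\<^esub> ?S \<subseteq> supported ?U"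
    proof (rule genideal_minimal)
      show "ideal (supported ?U) (mpoly_ring :: ('v, 'k) mpoly ring)"
      proof (rule ideal_supported)
        fix m n assume "m \<in> ?U"
        then obtain n' g where "m = n' + g" "g \<in> G" by auto
        then have "n + m = (n + n') + g" by (simp add: add.assoc)
        with \<open>g \<in> G\<close> show "n + m \<in> ?U" by blast
      qed
      show "?S \<subseteq> supported ?U"
      proof clarify
        fix g assume "g \<in> G"
        moreover have "g = 0 + g" by simp
        ultimately have "g \<in> ?U" by blast
        then show "Poly_Mapping.single g 1 \<in> supported ?U" by (rule supported_single)
      qed
    qed
    show "supported ?U \<subseteq> Idl\<^bsub>mpoly_ring\<^esub> ?S"
    proof
      fix p :: "('v, 'k) mpoly" assume "p \<in> supported ?U"
      then show "p \<in> Idl\<^bsub>mpoly_ring\<^esub> ?S"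
      proof (induction p rule: supported_induct)
        case zero
        show ?case using I.zero_closed by simp
      next
        case (single m k)
        then obtain n g where m: "m = n + g" and "g \<in> G" by auto
        then have "Poly_Mapping.single g 1 \<in> Idl\<^bsub>mpoly_ring\<^esub> ?S"
          using genideal_self[of ?S] by auto
        from I.I_l_closed[OF this, of "Poly_Mapping.single n k"]
        show ?case by (simp add: mult_single m)
      next
        case (add p q)
        then show ?case using I.a_closed by fastforce
      qed
    qed
  qed
qed

text \<open>
  The weak Lefschetz property, with the quotient ring and its components eliminated: everything is
  expressed by representatives in the polynomial ring.
\<close>

lemma weak_LefschetzI:
  fixes I :: "('v, 'k::comm_ring_1) mpoly set"
  assumes "ideal I mpoly_ring" and l: "l \<in> poly_component 1"
    and *: "\<And>d. (\<forall>p\<in>poly_component d. l * p \<in> I \<longrightarrow> p \<in> I) \<or>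
                (\<forall>p\<in>poly_component (d + 1). \<exists>g\<in>poly_component d. p - l * g \<in> I)"
    and comp_l: "\<And>d g. g \<in> poly_component d \<Longrightarrow> l * g \<in> poly_component (d + 1)"
    and comp_diff: "\<And>d p q :: ('v, 'k) mpoly. p \<in> poly_component d \<Longrightarrow> q \<in> poly_component d \<Longrightarrow>
      p - q \<in> poly_component d"
  shows "weak_Lefschetz (mpoly_ring Quot I) (quot_component I)"
proof -
  interpret ideal I "mpoly_ring :: ('v, 'k) mpoly ring" by (rule assms(1))
  define cs where "cs p = I +>\<^bsub>mpoly_ring\<^esub> p" for p
  have cs_eq: "cs p = cs q \<longleftrightarrow> p - q \<in> I" for p q
    using quotient_eq_iff_same_a_r_cos[OF assms(1), of p q] by (simp add: cs_def a_minus_def)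
  have mult: "cs p \<otimes>\<^bsub>mpoly_ring Quot I\<^esub> cs q = cs (p * q)" for p q
    by (simp add: cs_def FactRing_def rcoset_mult_add)
  have comp: "quot_component I d = cs ` poly_component d" for d
    by (simp add: quot_component_def cs_def)
  show ?thesis unfolding weak_Lefschetz_def
  proof (rule bexI[of _ "cs l"], rule allI)
    show "cs l \<in> quot_component I 1" using l by (simp add: comp)
    fix d
    show "inj_on (\<lambda>q. cs l \<otimes>\<^bsub>mpoly_ring Quot I\<^esub> q) (quot_component I d) \<or>
      (\<lambda>q. cs l \<otimes>\<^bsub>mpoly_ring Quot I\<^esub> q) ` quot_component I d = quot_component I (d + 1)"
      using *[of d]
    proof
      assume inj: "\<forall>p\<in>poly_component d. l * p \<in> I \<longrightarrow> p \<in> I"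
      have "inj_on (\<lambda>q. cs l \<otimes>\<^bsub>mpoly_ring Quot I\<^esub> q) (quot_component I d)"
        using inj comp_diff
        by (auto simp: inj_on_def comp mult cs_eq simp flip: right_diff_distrib)
      then show ?thesis ..
    next
      assume surj: "\<forall>p\<in>poly_component (d + 1). \<exists>g\<in>poly_component d. p - l * g \<in> I"
      have "(\<lambda>q. cs l \<otimes>\<^bsub>mpoly_ring Quot I\<^esub> q) ` quot_component I d = quot_component I (d + 1)"
        unfolding comp image_image mult
      proof
        show "(\<lambda>g. cs (l * g)) ` poly_component d \<subseteq> cs ` poly_component (d + 1)"
          using comp_l by blast
        show "cs ` poly_component (d + 1) \<subseteq> (\<lambda>g. cs (l * g)) ` poly_component d"
          using surj cs_eq by blast
      qed
      then show ?thesis ..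
    qed
  qed
qed

section \<open>Ternary polynomials modulo the linear form\<close>

definition expo :: "nat \<Rightarrow> nat \<Rightarrow> nat \<Rightarrow> xyz \<Rightarrow>\<^sub>0 nat" where
  "expo i j k = Poly_Mapping.single Vx i + Poly_Mapping.single Vy j + Poly_Mapping.single Vz k"

lemma lookup_expo [simp]:
  "Poly_Mapping.lookup (expo i j k) Vx = i"
  "Poly_Mapping.lookup (expo i j k) Vy = j"
  "Poly_Mapping.lookup (expo i j k) Vz = k"
  by (simp_all add: expo_def lookup_add lookup_single)

lemma xyz_exponent_eq_iff:
  "m = n \<longleftrightarrow> Poly_Mapping.lookup m Vx = Poly_Mapping.lookup n Vx \<and>
    Poly_Mapping.lookup m Vy = Poly_Mapping.lookup n Vy \<and>
    Poly_Mapping.lookup m Vz = Poly_Mapping.lookup n Vz"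
proof
  assume *: "Poly_Mapping.lookup m Vx = Poly_Mapping.lookup n Vx \<and>
    Poly_Mapping.lookup m Vy = Poly_Mapping.lookup n Vy \<and>
    Poly_Mapping.lookup m Vz = Poly_Mapping.lookup n Vz"
  show "m = n"
  proof (rule poly_mapping_eqI)
    fix v show "Poly_Mapping.lookup m v = Poly_Mapping.lookup n v"
      using * by (cases v) auto
  qed
qed auto

lemma expo_exhaust: obtains i j k where "m = expo i j k"
  using xyz_exponent_eq_iff[of m] by auto

lemma expo_eq_iff [simp]: "expo i j k = expo i' j' k' \<longleftrightarrow> i = i' \<and> j = j' \<and> k = k'"
  by (simp add: xyz_exponent_eq_iff)

lemma expo_add: "expo i j k + expo i' j' k' = expo (i + i') (j + j') (k + k')"
  by (simp add: xyz_exponent_eq_iff lookup_add)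

lemma mon_deg_xyz: "mon_deg (m :: xyz \<Rightarrow>\<^sub>0 nat) =
  Poly_Mapping.lookup m Vx + Poly_Mapping.lookup m Vy + Poly_Mapping.lookup m Vz"
proof -
  have "mon_deg m = (\<Sum>v\<in>{Vx, Vy, Vz}. Poly_Mapping.lookup m v)"
    unfolding mon_deg_def
    by (rule sum.mono_neutral_left) (auto simp: in_keys_iff intro: xyz.exhaust)
  then show ?thesis by simp
qed

lemma mon_deg_expo [simp]: "mon_deg (expo i j k) = i + j + k"
  by (simp add: mon_deg_xyz)

lemma mon_deg_add: "mon_deg (m + n :: xyz \<Rightarrow>\<^sub>0 nat) = mon_deg m + mon_deg n"
  by (simp add: mon_deg_xyz lookup_add)

lemma poly_component_eq_supported: "poly_component d = supported {m. int (mon_deg m) = d}"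
  by (auto simp: poly_component_def supported_def)

lemma component_mult:
  fixes p q :: "(xyz, 'k::comm_ring_1) mpoly"
  assumes "p \<in> poly_component d" "q \<in> poly_component e"
  shows "p * q \<in> poly_component (d + e)"
  using assms unfolding poly_component_eq_supported
  by (rule supported_mult) (simp add: mon_deg_add)

lemma component_add: "p \<in> poly_component d \<Longrightarrow> q \<in> poly_component d \<Longrightarrow> p + q \<in> poly_component d"
  by (simp add: poly_component_eq_supported supported_add)

lemma component_diff: "p \<in> poly_component d \<Longrightarrow> q \<in> poly_component d \<Longrightarrow> p - q \<in> poly_component d"
  by (simp add: poly_component_eq_supported supported_diff)

lemma single_in_component: "int (mon_deg m) = d \<Longrightarrow> Poly_Mapping.single m k \<in> poly_component d"
  by (simp add: poly_component_eq_supported supported_single)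

lemma var_eq_single:
  "var Vx = Poly_Mapping.single (expo 1 0 0) 1"
  "var Vy = Poly_Mapping.single (expo 0 1 0) 1"
  "var Vz = Poly_Mapping.single (expo 0 0 1) 1"
  by (simp_all add: var_def expo_def)

lemma var_power:
  "var Vx ^ n = Poly_Mapping.single (expo n 0 0) 1"
  "var Vy ^ n = Poly_Mapping.single (expo 0 n 0) 1"
  "var Vz ^ n = Poly_Mapping.single (expo 0 0 n) 1"
  by (induction n; simp add: var_eq_single mult_single expo_add; simp add: expo_def)+

lemma component_var_power: "var (v :: xyz) ^ n \<in> poly_component (int n)"
  by (cases v) (simp_all add: var_power single_in_component)

lemma component_var: "var (v :: xyz) \<in> poly_component 1"
  using component_var_power[of v 1] by simp

text \<open>
  The negative sign of \<open>x + y\<close> makes \<open>z\<close> congruent to \<open>x + y\<close> rather than to \<open>- (x + y)\<close>, which keeps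
  signs out of the multiplication matrix.
\<close>

definition ell :: "(xyz, 'k::comm_ring_1) mpoly" where
  "ell = var Vz - (var Vx + var Vy)"

lemma ell_in_component: "ell \<in> poly_component 1"
  by (simp add: ell_def component_var component_add component_diff)

lemma xy_power_sum:
  "(var Vx + var Vy) ^ n =
    (\<Sum>l\<le>n. Poly_Mapping.single (expo l (n - l) 0) (of_nat (n choose l) :: 'k::comm_ring_1))"
  unfolding binomial_ring
  by (intro sum.cong refl)
     (simp add: var_power mult_single expo_add flip: single_of_nat; simp add: mult_single)

definition zfree :: "(xyz \<Rightarrow>\<^sub>0 nat) set" where
  "zfree = {m. Poly_Mapping.lookup m Vz = 0}"

lemma zfree_mult: "p \<in> supported zfree \<Longrightarrow> q \<in> supported zfree \<Longrightarrow> p * q \<in> supported zfree"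
  by (rule supported_mult) (auto simp: zfree_def lookup_add)

lemma expo_zfree [simp]: "expo i j 0 \<in> zfree"
  by (simp add: zfree_def)

lemma zfree_xy_power: "(var Vx + var Vy) ^ n \<in> supported zfree"
  unfolding xy_power_sum by (intro supported_sum supported_single) simp

lemma component_xy_power: "(var Vx + var Vy) ^ n \<in> poly_component (int n)"
  unfolding xy_power_sum poly_component_eq_supported
  by (intro supported_sum supported_single) simp

text \<open>
  The cofactor is the telescoping sum for \<open>z^n - (x + y)^n\<close>. For \<open>n = 0\<close> it has degree \<open>- 1\<close>,
  that is, it is zero.
\<close>

lemma var_z_power_mod_ell:
  "\<exists>w\<in>poly_component (int n - 1). var Vz ^ n = (var Vx + var Vy) ^ n + ell * (w :: (xyz, 'k::comm_ring_1) mpoly)"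
proof (induction n)
  case 0
  show ?case by (rule bexI[of _ 0]) (simp_all add: poly_component_def)
next
  case (Suc n)
  then obtain w :: "(xyz, 'k) mpoly" where w: "w \<in> poly_component (int n - 1)"
    "var Vz ^ n = (var Vx + var Vy) ^ n + ell * w" by blast
  have "(var Vx + var Vy) ^ n + var Vz * w \<in> poly_component (int n)"
    using component_mult[OF component_var[of Vz] w(1)] by (simp add: component_add component_xy_power)
  moreover have "var Vz ^ Suc n = (var Vx + var Vy) ^ Suc n + ell * ((var Vx + var Vy) ^ n + var Vz * w)"
    by (simp add: w(2)) (simp add: ell_def algebra_simps)
  ultimately show ?case by force
qed

text \<open>
  In each monomial, the power of \<open>z\<close> is replaced by the same power of \<open>x + y\<close>.
\<close>

lemma eliminate_z:
  fixes p :: "(xyz, 'k::comm_ring_1) mpoly"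
  assumes "p \<in> poly_component d"
  shows "\<exists>h\<in>poly_component (d - 1). \<exists>r\<in>poly_component d \<inter> supported zfree. p = ell * h + r"
  using assms unfolding poly_component_eq_supported[of d]
proof (induction p rule: supported_induct)
  case zero
  show ?case by (intro bexI[of _ 0]) (simp_all add: poly_component_def)
next
  case (single m k)
  obtain a b c where m: "m = expo a b c" by (rule expo_exhaust)
  obtain w :: "(xyz, 'k) mpoly" where w: "w \<in> poly_component (int c - 1)"
    "var Vz ^ c = (var Vx + var Vy) ^ c + ell * w" using var_z_power_mod_ell by blast
  let ?t = "Poly_Mapping.single (expo a b 0) k"
  have d: "d = int a + int b + int c" using single by (simp add: m)
  have t: "?t \<in> poly_component (int a + int b)" by (simp add: single_in_component)
  have "Poly_Mapping.single m k = ?t * var Vz ^ c"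
    by (simp add: m var_power mult_single expo_add)
  then have "Poly_Mapping.single m k = ell * (?t * w) + ?t * (var Vx + var Vy) ^ c"
    by (simp add: w(2) algebra_simps)
  moreover have "?t * w \<in> poly_component (d - 1)"
    using component_mult[OF t w(1)] by (simp add: d algebra_simps)
  moreover have "?t * (var Vx + var Vy) ^ c \<in> poly_component d \<inter> supported zfree"
    using component_mult[OF t component_xy_power[of c]]
    by (simp add: d zfree_mult supported_single zfree_xy_power)
  ultimately show ?case by (auto simp: poly_component_eq_supported[of d])
next
  case (add p q)
  then obtain h h' r r' where
    "h \<in> poly_component (d - 1)" "h' \<in> poly_component (d - 1)"
    "r \<in> supported {m. int (mon_deg m) = d} \<inter> supported zfree"
    "r' \<in> supported {m. int (mon_deg m) = d} \<inter> supported zfree"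
    "p = ell * h + r" "q = ell * h' + r'" by blast
  then show ?case
    by (intro bexI[of _ "h + h'"] bexI[of _ "r + r'"])
       (auto simp: distrib_left component_add supported_add)
qed

text \<open>
  The exponents of the monomials in the ideal \<open>(x^a, y^b)\<close>.
\<close>

definition xy_big :: "nat \<Rightarrow> nat \<Rightarrow> (xyz \<Rightarrow>\<^sub>0 nat) set" where
  "xy_big a b = {m. a \<le> Poly_Mapping.lookup m Vx \<or> b \<le> Poly_Mapping.lookup m Vy}"

lemma xy_big_mult: "p \<in> supported (xy_big a b) \<Longrightarrow> q * p \<in> supported (xy_big a b)"
  by (erule supported_up_mult) (auto simp: xy_big_def lookup_add)

lemma lookup_var_mult:
  fixes u :: "(xyz, 'k::comm_ring_1) mpoly"
  shows "Poly_Mapping.lookup (var Vx * u) (expo i j k) =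
      (if i = 0 then 0 else Poly_Mapping.lookup u (expo (i - 1) j k))" (is ?x)
    and "Poly_Mapping.lookup (var Vy * u) (expo i j k) =
      (if j = 0 then 0 else Poly_Mapping.lookup u (expo i (j - 1) k))" (is ?y)
    and "Poly_Mapping.lookup (var Vz * u) (expo i j k) =
      (if k = 0 then 0 else Poly_Mapping.lookup u (expo i j (k - 1)))" (is ?z)
proof -
  show ?x
    using lookup_single_mult_add[of "expo 1 0 0" 1 u "expo (i - 1) j k"]
    by (auto simp: var_eq_single expo_add xyz_exponent_eq_iff lookup_add intro!: lookup_single_mult_not)
  show ?y
    using lookup_single_mult_add[of "expo 0 1 0" 1 u "expo i (j - 1) k"]
    by (auto simp: var_eq_single expo_add xyz_exponent_eq_iff lookup_add intro!: lookup_single_mult_not)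
  show ?z
    using lookup_single_mult_add[of "expo 0 0 1" 1 u "expo i j (k - 1)"]
    by (auto simp: var_eq_single expo_add xyz_exponent_eq_iff lookup_add intro!: lookup_single_mult_not)
qed

text \<open>
  Since \<open>\<ell>\<close> is monic in \<open>z\<close>, a term of \<open>u\<close> outside \<open>(x^a, y^b)\<close> of largest degree in \<open>z\<close> would
  contribute to \<open>\<ell> u\<close> a term that nothing cancels and that involves \<open>z\<close>. With \<open>r = 0\<close> this says that
  \<open>\<ell>\<close> is a nonzerodivisor modulo \<open>(x^a, y^b)\<close>.
\<close>

lemma ell_mult_mod_xy_big:
  fixes u r :: "(xyz, 'k::comm_ring_1) mpoly"
  assumes eq: "ell * u - r \<in> supported (xy_big a b)" and r: "r \<in> supported zfree"
  shows "u \<in> supported (xy_big a b)"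
proof (rule ccontr)
  assume "u \<notin> supported (xy_big a b)"
  define S where "S = Poly_Mapping.keys u - xy_big a b"
  from \<open>u \<notin> _\<close> have ne: "S \<noteq> {}" by (auto simp: S_def supported_def)
  have fin: "finite S" by (simp add: S_def)
  obtain m where m: "m \<in> S" and max: "\<And>n. n \<in> S \<Longrightarrow> Poly_Mapping.lookup n Vz \<le> Poly_Mapping.lookup m Vz"
    using Max_in[of "(\<lambda>n. Poly_Mapping.lookup n Vz) ` S"]
      Max_ge[of "(\<lambda>n. Poly_Mapping.lookup n Vz) ` S"] fin ne by fastforce
  obtain i j k where ijk: "m = expo i j k" by (rule expo_exhaust)
  have ij: "i < a" "j < b" using m by (auto simp: S_def xy_big_def ijk)
  have higher: "Poly_Mapping.lookup u (expo i' j' (k + 1)) = 0" if "i' < a" "j' < b" for i' j'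
    using max[of "expo i' j' (k + 1)"] that by (auto simp: S_def ijk xy_big_def in_keys_iff)
  have "Poly_Mapping.lookup (ell * u - r) (expo i j (k + 1)) = 0"
    by (rule supportedD[OF eq]) (use ij in \<open>simp add: xy_big_def\<close>)
  moreover have "Poly_Mapping.lookup r (expo i j (k + 1)) = 0"
    by (rule supportedD[OF r]) (simp add: zfree_def)
  ultimately have "Poly_Mapping.lookup u (expo i j k) = 0"
    using higher[of "i - 1" j] higher[of i "j - 1"] ij
    by (auto simp: ell_def left_diff_distrib distrib_right lookup_minus lookup_add lookup_var_mult
        split: if_splits)
  then show False using m by (simp add: S_def ijk in_keys_iff)
qed

section \<open>The multiplication matrix in two variables\<close>

text \<open>
  The form of degree \<open>M - 1\<close> in \<open>x\<close> and \<open>y\<close> with coefficients \<open>v 0, \<dots>, v (M - 1)\<close>; for \<open>M = 0\<close> it is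
  zero.
\<close>

definition binary_form :: "nat \<Rightarrow> (nat \<Rightarrow> 'k) \<Rightarrow> (xyz, 'k::comm_ring_1) mpoly" where
  "binary_form M v = (\<Sum>k<M. Poly_Mapping.single (expo k (M - 1 - k) 0) (v k))"

lemma binary_form_zfree: "binary_form M v \<in> supported zfree"
  unfolding binary_form_def by (intro supported_sum supported_single) simp

lemma binary_form_component: "binary_form M v \<in> poly_component (int M - 1)"
  unfolding binary_form_def poly_component_eq_supported
  by (intro supported_sum supported_single) auto

lemma lookup_binary_form:
  assumes "i < M"
  shows "Poly_Mapping.lookup (binary_form M v) (expo i (M - 1 - i) 0) = v i"
proof -
  have "Poly_Mapping.lookup (binary_form M v) (expo i (M - 1 - i) 0) = (\<Sum>k<M. if k = i then v k else 0)"
    unfolding binary_form_def lookup_sum lookup_single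
    by (rule sum.cong) (auto simp: when_def)
  then show ?thesis using assms by simp
qed

lemma binary_form_of_zfree:
  assumes "r \<in> poly_component (int M - 1)" "r \<in> supported zfree"
  shows "r = binary_form M (\<lambda>k. Poly_Mapping.lookup r (expo k (M - 1 - k) 0))"
proof (rule poly_mapping_eqI)
  fix m
  obtain i j k where m: "m = expo i j k" by (rule expo_exhaust)
  show "Poly_Mapping.lookup r m =
    Poly_Mapping.lookup (binary_form M (\<lambda>k. Poly_Mapping.lookup r (expo k (M - 1 - k) 0))) m"
  proof (cases "k = 0 \<and> i < M \<and> j = M - 1 - i")
    case True
    then show ?thesis
      using lookup_binary_form[of i M "\<lambda>k. Poly_Mapping.lookup r (expo k (M - 1 - k) 0)"]
      by (simp add: m)
  next
    case False
    have "Poly_Mapping.lookup r m = 0"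
    proof (cases "k = 0")
      case True
      with False have "int (mon_deg m) \<noteq> int M - 1" by (auto simp: m)
      then show ?thesis using assms(1) by (auto simp: poly_component_eq_supported elim: supportedD)
    next
      case False
      then show ?thesis by (intro supportedD[OF assms(2)]) (simp add: m zfree_def)
    qed
    moreover have "Poly_Mapping.lookup (binary_form M w) m = 0" for w :: "nat \<Rightarrow> 'a"
      using False by (auto simp: binary_form_def m lookup_sum lookup_single when_def intro!: sum.neutral)
    ultimately show ?thesis by simp
  qed
qed

text \<open>
  The residue \<open>x^\<alpha> y^\<beta> (x + y)^n\<close> of the monomial \<open>x^\<alpha> y^\<beta> z^n\<close> modulo \<open>\<ell>\<close>.
\<close>

definition xy_generator :: "nat \<Rightarrow> nat \<Rightarrow> nat \<Rightarrow> (xyz, 'k::comm_ring_1) mpoly" where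
  "xy_generator \<alpha> \<beta> n = Poly_Mapping.single (expo \<alpha> \<beta> 0) 1 * (var Vx + var Vy) ^ n"

lemma xy_generator_zfree: "xy_generator \<alpha> \<beta> n \<in> supported zfree"
  by (simp add: xy_generator_def zfree_mult supported_single zfree_xy_power)

lemma xy_generator_component: "xy_generator \<alpha> \<beta> n \<in> poly_component (int (\<alpha> + \<beta> + n))"
  using component_mult[OF single_in_component[OF refl, of "expo \<alpha> \<beta> 0" 1] component_xy_power[of n]]
  by (simp add: xy_generator_def)

text \<open>
  The exponents considered, for \<open>i < M\<close>, are those of all monomials of degree \<open>c - 1\<close> in \<open>x\<close> and
  \<open>y\<close> outside \<open>(x^a, y^b)\<close>, where \<open>a = \<alpha> + q + M\<close>, \<open>b = \<beta> + p + M\<close> and \<open>c = \<alpha> + \<beta> + p + q + M\<close>. The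
  product of the \<open>l\<close>-th term of \<open>(x + y)^(p + q)\<close> and the \<open>k\<close>-th term of the form contributes exactly
  for \<open>l = q + i - k\<close>.
\<close>

lemma lookup_xy_generator_mult:
  fixes v :: "nat \<Rightarrow> 'k::comm_ring_1"
  assumes "i < M"
  shows "Poly_Mapping.lookup (xy_generator \<alpha> \<beta> (p + q) * binary_form M v)
      (expo (\<alpha> + q + i) (\<beta> + p + M - 1 - i) 0) =
    (\<Sum>k<M. (if k \<le> q + i then of_nat ((p + q) choose (q + i - k)) else 0) * v k)"
proof -
  let ?m = "expo (\<alpha> + q + i) (\<beta> + p + M - 1 - i) 0"
  have "xy_generator \<alpha> \<beta> (p + q) * binary_form M v =
    (\<Sum>k<M. \<Sum>l\<le>p+q. Poly_Mapping.single (expo (\<alpha> + l + k) (\<beta> + (p + q - l) + (M - 1 - k)) 0)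
       (of_nat ((p + q) choose l) * v k))"
    unfolding xy_generator_def xy_power_sum binary_form_def sum_distrib_left sum_distrib_right
    by (simp add: mult_single expo_add)
  then have "Poly_Mapping.lookup (xy_generator \<alpha> \<beta> (p + q) * binary_form M v) ?m =
    (\<Sum>k<M. \<Sum>l\<le>p+q. of_nat ((p + q) choose l) * v k when
       expo (\<alpha> + l + k) (\<beta> + (p + q - l) + (M - 1 - k)) 0 = ?m)"
    by (simp only: lookup_sum lookup_single)
  also have "\<dots> = (\<Sum>k<M. (if k \<le> q + i then of_nat ((p + q) choose (q + i - k)) else 0) * v k)"
  proof (rule sum.cong[OF refl])
    fix k assume "k \<in> {..<M}"
    then have eq: "expo (\<alpha> + l + k) (\<beta> + (p + q - l) + (M - 1 - k)) 0 = ?m \<longleftrightarrow> k \<le> q + i \<and> l = q + i - k"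
      if "l \<le> p + q" for l
      using that assms by auto
    have "(\<Sum>l\<le>p+q. of_nat ((p + q) choose l) * v k when
        expo (\<alpha> + l + k) (\<beta> + (p + q - l) + (M - 1 - k)) 0 = ?m) =
      (\<Sum>l\<le>p+q. if l = q + i - k then (if k \<le> q + i then of_nat ((p + q) choose l) * v k else 0) else 0)"
      by (rule sum.cong[OF refl]) (use eq in \<open>auto simp: when_def\<close>)
    also have "\<dots> = (if k \<le> q + i then of_nat ((p + q) choose (q + i - k)) else 0) * v k"
      by (auto simp: sum.delta binomial_eq_0)
    finally show "(\<Sum>l\<le>p+q. of_nat ((p + q) choose l) * v k when
        expo (\<alpha> + l + k) (\<beta> + (p + q - l) + (M - 1 - k)) 0 = ?m) =
      (if k \<le> q + i then of_nat ((p + q) choose (q + i - k)) else 0) * v k" .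
  qed
  finally show ?thesis .
qed

lemma lookup_xy_generator_mult_mat:
  fixes v :: "nat \<Rightarrow> 'k::comm_ring_1"
  assumes "i < M"
  shows "Poly_Mapping.lookup (xy_generator \<alpha> \<beta> (p + q) * binary_form M v)
      (expo (\<alpha> + q + i) (\<beta> + p + M - 1 - i) 0) =
    (binom_toeplitz M (p + q) q *\<^sub>v vec M v) $ i"
  unfolding lookup_xy_generator_mult[OF assms] using assms
  by (auto simp: binom_toeplitz_def scalar_prod_def atLeast0LessThan intro!: sum.cong)

text \<open>
  For \<open>e = M - 1\<close> the coefficients of \<open>r\<close> form a vector in the kernel of the Toeplitz matrix; lower
  degrees reduce to this one by multiplication with a power of \<open>y\<close>.
\<close>

lemma xy_generator_mult_injective:
  fixes r :: "(xyz, 'k::field) mpoly"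
  assumes det: "det (binom_toeplitz M (p + q) q :: 'k mat) \<noteq> 0"
    and r: "r \<in> poly_component e" "r \<in> supported zfree" and e: "e < int M"
    and prod: "xy_generator \<alpha> \<beta> (p + q) * r \<in> supported (xy_big (\<alpha> + q + M) (\<beta> + p + M))"
  shows "r = 0"
proof (rule ccontr)
  assume "r \<noteq> 0"
  then obtain m where m: "m \<in> Poly_Mapping.keys r"
    by (metis in_keys_iff lookup_zero poly_mapping_eqI)
  define t where "t = expo 0 (M - 1 - mon_deg m) 0"
  have me: "int (mon_deg m) = e" using m r(1) by (auto simp: poly_component_def)
  define r' where "r' = Poly_Mapping.single t 1 * r"
  define v where "v k = Poly_Mapping.lookup r' (expo k (M - 1 - k) 0)" for k
  have "r' \<in> poly_component (int M - 1)"
    using component_mult[OF single_in_component[of t "int M - 1 - e" 1] r(1)] me e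
    by (auto simp: r'_def t_def)
  moreover have "r' \<in> supported zfree"
    unfolding r'_def by (intro zfree_mult supported_single r) (simp add: t_def)
  ultimately have r'_form: "r' = binary_form M v"
    unfolding v_def by (rule binary_form_of_zfree)
  have "xy_generator \<alpha> \<beta> (p + q) * r' \<in> supported (xy_big (\<alpha> + q + M) (\<beta> + p + M))"
    using xy_big_mult[OF prod, of "Poly_Mapping.single t 1"] by (simp add: r'_def mult_ac)
  then have "(binom_toeplitz M (p + q) q *\<^sub>v vec M v) $ i = 0" if "i < M" for i
    unfolding lookup_xy_generator_mult_mat[OF that, of \<alpha> \<beta>, symmetric] r'_form
    by (rule supportedD) (use that in \<open>auto simp: xy_big_def\<close>)
  then have "binom_toeplitz M (p + q) q *\<^sub>v vec M v = 0\<^sub>v M"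
    by (intro eq_vecI) (auto simp: binom_toeplitz_def)
  then have "vec M v = 0\<^sub>v M"
    using det_0_iff_vec_prod_zero_field[OF binom_toeplitz_carrier] det by (metis vec_carrier)
  then have "v k = 0" if "k < M" for k
    using that by (metis index_vec index_zero_vec(1))
  then have "r' = 0" by (simp add: r'_form binary_form_def)
  then have "Poly_Mapping.lookup r m = 0"
    using lookup_single_mult_add[of t 1 r m] by (simp add: r'_def)
  then show False using m by (simp add: in_keys_iff)
qed

text \<open>
  The coefficient vector is the column \<open>i0\<close> of the inverse Toeplitz matrix; by degree reasons, the two
  polynomials can differ outside \<open>(x^a, y^b)\<close> only in the \<open>M\<close> coefficients given by the matrix.
\<close>

lemma xy_generator_mult_surjective:
  assumes det: "det (binom_toeplitz M (p + q) q :: 'k::field mat) \<noteq> 0" and i0: "i0 < M"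
  shows "\<exists>v :: nat \<Rightarrow> 'k. Poly_Mapping.single (expo (\<alpha> + q + i0) (\<beta> + p + M - 1 - i0) 0) 1
      - xy_generator \<alpha> \<beta> (p + q) * binary_form M v \<in> supported (xy_big (\<alpha> + q + M) (\<beta> + p + M))"
proof -
  let ?T = "binom_toeplitz M (p + q) q :: 'k mat"
  let ?m = "\<lambda>i. expo (\<alpha> + q + i) (\<beta> + p + M - 1 - i) 0"
  have adj: "adj_mat ?T \<in> carrier_mat M M" "?T * adj_mat ?T = det ?T \<cdot>\<^sub>m 1\<^sub>m M"
    using adj_mat[of ?T M] by auto
  define w where "w = (1 / det ?T) \<cdot>\<^sub>v col (adj_mat ?T) i0"
  have wM: "w \<in> carrier_vec M" by (intro carrier_vecI) (simp add: w_def carrier_matD(1)[OF adj(1)])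
  have "?T *\<^sub>v w = (1 / det ?T) \<cdot>\<^sub>v (?T *\<^sub>v col (adj_mat ?T) i0)"
    unfolding w_def
    by (intro mult_mat_vec[OF binom_toeplitz_carrier] carrier_vecI) (simp add: carrier_matD(1)[OF adj(1)])
  also have "?T *\<^sub>v col (adj_mat ?T) i0 = col (det ?T \<cdot>\<^sub>m 1\<^sub>m M) i0"
    using col_mult2[of ?T M M "adj_mat ?T" M i0] adj i0 by simp
  also have "(1 / det ?T) \<cdot>\<^sub>v \<dots> = unit_vec M i0"
    using det i0 by (intro eq_vecI) auto
  finally have Tw: "?T *\<^sub>v vec M (\<lambda>i. w $ i) = unit_vec M i0"
    using wM by (metis carrier_vecD vec_eq_iff dim_vec index_vec)
  let ?P = "xy_generator \<alpha> \<beta> (p + q) * binary_form M (\<lambda>i. w $ i)"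
  have Pz: "?P \<in> supported zfree"
    by (intro zfree_mult xy_generator_zfree binary_form_zfree)
  have Pd: "?P \<in> poly_component (int (\<alpha> + \<beta> + (p + q)) + (int M - 1))"
    by (intro component_mult xy_generator_component binary_form_component)
  have "Poly_Mapping.single (?m i0) 1 - ?P \<in> supported (xy_big (\<alpha> + q + M) (\<beta> + p + M))"
  proof (rule supportedI)
    fix m assume m: "m \<notin> xy_big (\<alpha> + q + M) (\<beta> + p + M)"
    obtain x y z where xyz: "m = expo x y z" by (rule expo_exhaust)
    show "Poly_Mapping.lookup (Poly_Mapping.single (?m i0) 1 - ?P) m = 0"
    proof (cases "z = 0 \<and> x + y = \<alpha> + \<beta> + p + q + M - 1")
      case True
      with m i0 obtain i where i: "i < M" "m = ?m i"
        by (intro that[of "x - \<alpha> - q"]) (auto simp: xyz xy_big_def)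
      have "Poly_Mapping.lookup ?P m = (if i = i0 then 1 else 0)"
        unfolding i(2) lookup_xy_generator_mult_mat[OF i(1)] Tw using i(1) i0 by simp
      then show ?thesis by (auto simp: i lookup_minus lookup_single when_def)
    next
      case False
      have "m \<noteq> ?m i0" using False i0 by (auto simp: xyz)
      moreover have "Poly_Mapping.lookup ?P m = 0"
      proof (cases "z = 0")
        case True
        with False i0 have "int (mon_deg m) \<noteq> int (\<alpha> + \<beta> + (p + q)) + (int M - 1)" by (auto simp: xyz)
        then show ?thesis using Pd by (auto simp: poly_component_eq_supported elim: supportedD)
      next
        case False
        then show ?thesis by (intro supportedD[OF Pz]) (simp add: xyz zfree_def)
      qed
      ultimately show ?thesis by (simp add: lookup_minus lookup_single when_def)
    qed
  qed
  then show ?thesis by blast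
qed

section \<open>Multiplication by the linear form in each degree\<close>

text \<open>
  The exponents of the monomials in \<open>(x^a, y^b, z^c, x^\<alpha> y^\<beta> z^\<gamma>)\<close>.
\<close>

definition ideal_exponents :: "nat \<Rightarrow> nat \<Rightarrow> nat \<Rightarrow> nat \<Rightarrow> nat \<Rightarrow> nat \<Rightarrow> (xyz \<Rightarrow>\<^sub>0 nat) set" where
  "ideal_exponents a b c \<alpha> \<beta> \<gamma> = xy_big a b \<union> {m. c \<le> Poly_Mapping.lookup m Vz} \<union>
     {m. \<alpha> \<le> Poly_Mapping.lookup m Vx \<and> \<beta> \<le> Poly_Mapping.lookup m Vy \<and> \<gamma> \<le> Poly_Mapping.lookup m Vz}"

lemma ideal_exponents_up: "m \<in> ideal_exponents a b c \<alpha> \<beta> \<gamma> \<Longrightarrow> n + m \<in> ideal_exponents a b c \<alpha> \<beta> \<gamma>"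
  by (auto simp: ideal_exponents_def xy_big_def lookup_add)

lemma exponent_multiple_iff:
  "(\<exists>n. m = n + expo i j k) \<longleftrightarrow>
    i \<le> Poly_Mapping.lookup m Vx \<and> j \<le> Poly_Mapping.lookup m Vy \<and> k \<le> Poly_Mapping.lookup m Vz"
    (is "_ \<longleftrightarrow> ?R")
proof
  assume ?R
  then have "m = expo (Poly_Mapping.lookup m Vx - i) (Poly_Mapping.lookup m Vy - j)
      (Poly_Mapping.lookup m Vz - k) + expo i j k"
    by (simp add: xyz_exponent_eq_iff lookup_add)
  then show "\<exists>n. m = n + expo i j k" ..
qed (auto simp: lookup_add)

lemma monomial_ideal_eq_supported:
  "(monomial_ideal a b c \<alpha> \<beta> \<gamma> :: (xyz, 'k::field) mpoly set) = supported (ideal_exponents a b c \<alpha> \<beta> \<gamma>)"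
proof -
  let ?G = "{expo a 0 0, expo 0 b 0, expo 0 0 c, expo \<alpha> \<beta> \<gamma>}"
  have "{var Vx ^ a, var Vy ^ b, var Vz ^ c, var Vx ^ \<alpha> * var Vy ^ \<beta> * var Vz ^ \<gamma>} =
    (\<lambda>g. Poly_Mapping.single g (1::'k)) ` ?G"
    by (simp add: var_power mult_single expo_add)
  then have "(monomial_ideal a b c \<alpha> \<beta> \<gamma> :: (xyz, 'k) mpoly set) = supported {n + g |n g. g \<in> ?G}"
    by (simp only: monomial_ideal_def genideal_monomials)
  also have "{n + g |n g. g \<in> ?G} = {m. \<exists>g\<in>?G. \<exists>n. m = n + g}" by blast
  also have "\<dots> = ideal_exponents a b c \<alpha> \<beta> \<gamma>"
    by (auto simp: exponent_multiple_iff ideal_exponents_def xy_big_def)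
  finally show ?thesis .
qed

text \<open>
  In degrees below \<open>c\<close> the generator \<open>z^c\<close> cannot contribute. If \<open>d < \<alpha> + \<beta> + \<gamma>\<close>, the cofactor \<open>g\<close>
  has negative degree and vanishes.
\<close>

lemma split_by_generator:
  fixes P :: "(xyz, 'k::comm_ring_1) mpoly"
  assumes "P \<in> supported (ideal_exponents a b c \<alpha> \<beta> \<gamma>)" "P \<in> poly_component d" "d < int c"
  shows "\<exists>g\<in>poly_component (d - int (\<alpha> + \<beta> + \<gamma>)).
    P - Poly_Mapping.single (expo \<alpha> \<beta> \<gamma>) 1 * g \<in> supported (xy_big a b)"
proof -
  have "P \<in> supported (ideal_exponents a b c \<alpha> \<beta> \<gamma> \<inter> {m. int (mon_deg m) = d})"
    using assms(1,2) by (auto simp: poly_component_eq_supported supported_def)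
  then show ?thesis
  proof (induction P rule: supported_induct)
    case zero
    show ?case by (rule bexI[of _ 0]) (simp_all add: poly_component_def)
  next
    case (single m k)
    show ?case
    proof (cases "m \<in> xy_big a b")
      case True
      then show ?thesis
        by (intro bexI[of _ 0]) (simp_all add: poly_component_def supported_single)
    next
      case False
      have "\<not> c \<le> Poly_Mapping.lookup m Vz" using single assms(3) by (auto simp: mon_deg_xyz)
      with False single have "\<exists>n. m = n + expo \<alpha> \<beta> \<gamma>"
        by (auto simp: exponent_multiple_iff ideal_exponents_def)
      then obtain n where n: "m = expo \<alpha> \<beta> \<gamma> + n" by (auto simp: add.commute)
      have "int (mon_deg n) = d - int (\<alpha> + \<beta> + \<gamma>)" using single by (simp add: n mon_deg_add)
      then have "Poly_Mapping.single n k \<in> poly_component (d - int (\<alpha> + \<beta> + \<gamma>))"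
        by (rule single_in_component)
      then show ?thesis by (rule rev_bexI) (simp add: n mult_single)
    qed
  next
    case (add p q)
    then obtain g h where gh: "g \<in> poly_component (d - int (\<alpha> + \<beta> + \<gamma>))" "h \<in> poly_component (d - int (\<alpha> + \<beta> + \<gamma>))"
      "p - Poly_Mapping.single (expo \<alpha> \<beta> \<gamma>) 1 * g \<in> supported (xy_big a b)"
      "q - Poly_Mapping.single (expo \<alpha> \<beta> \<gamma>) 1 * h \<in> supported (xy_big a b)" by blast
    from supported_add[OF gh(3,4)] show ?case
      by (intro bexI[OF _ component_add[OF gh(1,2)]]) (simp add: algebra_simps)
  qed
qed

lemma generator_mod_ell:
  "\<exists>w\<in>poly_component (int (\<alpha> + \<beta> + \<gamma>) - 1). Poly_Mapping.single (expo \<alpha> \<beta> \<gamma>) 1 =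
    xy_generator \<alpha> \<beta> \<gamma> + ell * (w :: (xyz, 'k::comm_ring_1) mpoly)"
proof -
  obtain w :: "(xyz, 'k) mpoly" where w: "w \<in> poly_component (int \<gamma> - 1)"
    "var Vz ^ \<gamma> = (var Vx + var Vy) ^ \<gamma> + ell * w" using var_z_power_mod_ell by blast
  let ?s = "Poly_Mapping.single (expo \<alpha> \<beta> 0) 1 :: (xyz, 'k) mpoly"
  have "Poly_Mapping.single (expo \<alpha> \<beta> \<gamma>) 1 = ?s * var Vz ^ \<gamma>"
    by (simp add: var_power mult_single expo_add)
  also have "\<dots> = xy_generator \<alpha> \<beta> \<gamma> + ell * (?s * w)"
    by (simp add: w(2) xy_generator_def algebra_simps)
  moreover have "?s * w \<in> poly_component (int (\<alpha> + \<beta> + \<gamma>) - 1)"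
    using component_mult[OF single_in_component[OF refl, of "expo \<alpha> \<beta> 0" 1] w(1)]
    by (simp add: algebra_simps)
  ultimately show ?thesis by auto
qed

text \<open>
  With \<open>g\<close> the cofactor of the generator in \<open>\<ell> f\<close>, write \<open>g = \<ell> h + r\<close> with \<open>r\<close> free of
  \<open>z\<close>. Replacing the monomial generator by its residue modulo \<open>\<ell>\<close> turns the relation into
  \<open>\<ell> u = x^\<alpha> y^\<beta> (x + y)^\<gamma> r\<close> modulo \<open>(x^a, y^b)\<close>. Then \<open>u\<close> vanishes modulo
  \<open>(x^a, y^b)\<close>, so \<open>r = 0\<close> by the injectivity in two variables, and \<open>f\<close> differs from \<open>u\<close> by a multiple
  of the generator.
\<close>

lemma ell_injective:
  fixes f :: "(xyz, 'k::field) mpoly"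
  assumes det: "det (binom_toeplitz M (p + q) q :: 'k mat) \<noteq> 0"
    and c: "c = \<alpha> + \<beta> + (p + q) + M"
    and f: "f \<in> poly_component d" "d + 1 < int c"
    and lf: "ell * f \<in> supported (ideal_exponents (\<alpha> + q + M) (\<beta> + p + M) c \<alpha> \<beta> (p + q))"
  shows "f \<in> supported (ideal_exponents (\<alpha> + q + M) (\<beta> + p + M) c \<alpha> \<beta> (p + q))"
proof -
  let ?J = "supported (xy_big (\<alpha> + q + M) (\<beta> + p + M)) :: (xyz, 'k) mpoly set"
  let ?t = "Poly_Mapping.single (expo \<alpha> \<beta> (p + q)) 1 :: (xyz, 'k) mpoly"
  let ?e = "d + 1 - int (\<alpha> + \<beta> + (p + q))"
  have "ell * f \<in> poly_component (d + 1)"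
    using component_mult[OF ell_in_component f(1)] by (simp add: add.commute)
  from split_by_generator[OF lf this f(2)]
  obtain g where g: "g \<in> poly_component ?e" "ell * f - ?t * g \<in> ?J" by blast
  obtain h r where hr: "r \<in> poly_component ?e" "r \<in> supported zfree" "g = ell * h + r"
    using eliminate_z[OF g(1)] by blast
  obtain w where w: "?t = xy_generator \<alpha> \<beta> (p + q) + ell * w"
    using generator_mod_ell by blast
  let ?u = "f - ?t * h - w * r"
  have "ell * f - ?t * g = ell * ?u - xy_generator \<alpha> \<beta> (p + q) * r"
    unfolding hr(3) by (simp add: w algebra_simps)
  then have u: "ell * ?u - xy_generator \<alpha> \<beta> (p + q) * r \<in> ?J" using g(2) by simp
  then have uJ: "?u \<in> ?J"
    by (rule ell_mult_mod_xy_big) (intro zfree_mult xy_generator_zfree hr)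
  have "xy_generator \<alpha> \<beta> (p + q) * r \<in> ?J"
    using supported_diff[OF xy_big_mult[OF uJ, of ell] u] by simp
  then have "r = 0"
    using f(2) by (intro xy_generator_mult_injective[OF det hr(1,2)]) (simp_all add: c)
  have "?u + ?t * h \<in> supported (ideal_exponents (\<alpha> + q + M) (\<beta> + p + M) c \<alpha> \<beta> (p + q))"
  proof (rule supported_add)
    show "?u \<in> supported (ideal_exponents (\<alpha> + q + M) (\<beta> + p + M) c \<alpha> \<beta> (p + q))"
      using uJ by (rule supported_mono) (auto simp: ideal_exponents_def)
    have "?t \<in> supported (ideal_exponents (\<alpha> + q + M) (\<beta> + p + M) c \<alpha> \<beta> (p + q))"
      by (rule supported_single) (simp add: ideal_exponents_def)
    then show "?t * h \<in> supported (ideal_exponents (\<alpha> + q + M) (\<beta> + p + M) c \<alpha> \<beta> (p + q))"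
      using supported_up_mult[OF _ ideal_exponents_up] by (metis mult.commute)
  qed
  then show ?thesis by (simp add: \<open>r = 0\<close>)
qed

text \<open>
  A monomial \<open>x^i y^j\<close> of degree at least \<open>c - 1\<close> outside \<open>(x^a, y^b)\<close> is a multiple of such a monomial of
  degree exactly \<open>c - 1\<close>, to which the surjectivity in two variables applies.
\<close>

lemma monomial_in_image:
  assumes det: "det (binom_toeplitz M (p + q) q :: 'k::field mat) \<noteq> 0"
    and c: "c = \<alpha> + \<beta> + (p + q) + M"
    and ij: "int c \<le> int (i + j) + 1"
  shows "\<exists>g\<in>poly_component (int (i + j) - 1). Poly_Mapping.single (expo i j 0) k - ell * g
    \<in> (supported (ideal_exponents (\<alpha> + q + M) (\<beta> + p + M) c \<alpha> \<beta> (p + q)) :: (xyz, 'k) mpoly set)"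
    (is "\<exists>g\<in>_. _ \<in> ?I")
proof (cases "i < \<alpha> + q + M \<and> j < \<beta> + p + M")
  case False
  then have "Poly_Mapping.single (expo i j 0) k \<in> ?I"
    by (intro supported_single) (auto simp: ideal_exponents_def xy_big_def)
  then show ?thesis by (intro bexI[of _ 0]) (simp_all add: poly_component_def)
next
  case True
  \<comment> \<open>Only the exponent of \<open>y\<close> has to be lowered: \<open>j < b\<close> forces \<open>\<alpha> + q \<le> i\<close>.\<close>
  define i0 where "i0 = i - \<alpha> - q"
  have i0: "i0 < M" using True ij by (auto simp: c i0_def)
  have le: "\<alpha> + q + i0 = i" "\<beta> + p + M - 1 - i0 \<le> j" using True ij by (auto simp: c i0_def)
  let ?m = "expo (\<alpha> + q + i0) (\<beta> + p + M - 1 - i0) 0"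
  define t where "t = expo 0 (j - (\<beta> + p + M - 1 - i0)) 0"
  have tm: "t + ?m = expo i j 0" using le by (simp add: t_def expo_add)
  obtain v :: "nat \<Rightarrow> 'k" where v: "Poly_Mapping.single ?m 1 - xy_generator \<alpha> \<beta> (p + q) * binary_form M v
    \<in> supported (xy_big (\<alpha> + q + M) (\<beta> + p + M))"
    using xy_generator_mult_surjective[OF det i0] by blast
  obtain w :: "(xyz, 'k) mpoly" where w: "w \<in> poly_component (int (\<alpha> + \<beta> + (p + q)) - 1)"
    "Poly_Mapping.single (expo \<alpha> \<beta> (p + q)) 1 = xy_generator \<alpha> \<beta> (p + q) + ell * w"
    using generator_mod_ell by blast
  let ?s = "Poly_Mapping.single t k" and ?f = "binary_form M v"
  have up: "x * y \<in> ?I" if "y \<in> ?I" for x y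
    using that ideal_exponents_up by (rule supported_up_mult)
  have "Poly_Mapping.single ?m 1 - xy_generator \<alpha> \<beta> (p + q) * ?f \<in> ?I"
    using v by (rule supported_mono) (auto simp: ideal_exponents_def)
  moreover have "?f * Poly_Mapping.single (expo \<alpha> \<beta> (p + q)) 1 \<in> ?I"
    by (intro up supported_single) (simp add: ideal_exponents_def)
  ultimately have "?s * (Poly_Mapping.single ?m 1 - xy_generator \<alpha> \<beta> (p + q) * ?f +
      ?f * Poly_Mapping.single (expo \<alpha> \<beta> (p + q)) 1) \<in> ?I"
    by (intro up) (rule supported_add)
  also have "?s * (Poly_Mapping.single ?m 1 - xy_generator \<alpha> \<beta> (p + q) * ?f +
      ?f * Poly_Mapping.single (expo \<alpha> \<beta> (p + q)) 1) =
    ?s * Poly_Mapping.single ?m 1 - ell * (- (?s * (?f * w)))"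
    by (simp add: w(2) algebra_simps)
  also have "?s * Poly_Mapping.single ?m 1 = Poly_Mapping.single (expo i j 0) k"
    by (simp only: mult_single tm mult_1_right)
  finally have "Poly_Mapping.single (expo i j 0) k - ell * (- (?s * (?f * w))) \<in> ?I" .
  moreover have "- (?s * (?f * w)) \<in> poly_component (int (i + j) - 1)"
  proof -
    have "int (mon_deg t) + (int M - 1 + (int (\<alpha> + \<beta> + (p + q)) - 1)) = int (i + j) - 1"
      using le i0 by (simp add: t_def)
    then have "?s * (?f * w) \<in> poly_component (int (i + j) - 1)"
      using component_mult[OF single_in_component[OF refl] component_mult[OF binary_form_component w(1)]]
      by metis
    then show ?thesis by (simp add: poly_component_def)
  qed
  ultimately show ?thesis by (rule rev_bexI[rotated])
qed

lemma ell_surjective: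
  fixes f :: "(xyz, 'k::field) mpoly"
  assumes det: "det (binom_toeplitz M (p + q) q :: 'k::field mat) \<noteq> 0"
    and c: "c = \<alpha> + \<beta> + (p + q) + M"
    and f: "f \<in> poly_component (d + 1)" "int c \<le> d + 2"
  shows "\<exists>g\<in>poly_component d.
    f - ell * g \<in> supported (ideal_exponents (\<alpha> + q + M) (\<beta> + p + M) c \<alpha> \<beta> (p + q))"
    (is "\<exists>g\<in>_. _ \<in> ?I")
proof -
  obtain h r where hr: "h \<in> poly_component d" "r \<in> poly_component (d + 1)" "r \<in> supported zfree"
    "f = ell * h + r" using eliminate_z[OF f(1)] by auto
  have "r \<in> supported (zfree \<inter> {m. int (mon_deg m) = d + 1})"
    using hr(2,3) by (auto simp: poly_component_eq_supported supported_def)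
  then have "\<exists>g\<in>poly_component d. r - ell * g \<in> ?I"
  proof (induction r rule: supported_induct)
    case zero
    show ?case by (rule bexI[of _ 0]) (simp_all add: poly_component_def)
  next
    case (single m k)
    obtain i j z where "m = expo i j z" by (rule expo_exhaust)
    with single have m: "m = expo i j 0" "d = int (i + j) - 1" by (auto simp: zfree_def)
    show ?case using monomial_in_image[OF det c, of i j k] f(2) by (simp add: m)
  next
    case (add r r')
    then obtain g g' where g: "g \<in> poly_component d" "g' \<in> poly_component d"
      "r - ell * g \<in> ?I" "r' - ell * g' \<in> ?I" by blast
    from supported_add[OF g(3,4)] show ?case
      by (intro bexI[of _ "g + g'"]) (simp_all add: component_add g algebra_simps)
  qed
  then obtain g where g: "g \<in> poly_component d" "r - ell * g \<in> ?I" by blast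
  then show ?thesis
    by (intro bexI[of _ "h + g"]) (simp_all add: component_add hr algebra_simps)
qed

lemma weak_Lefschetz_monomial_ideal:
  assumes det: "det (binom_toeplitz M (p + q) q :: 'k::field mat) \<noteq> 0"
    and c: "c = \<alpha> + \<beta> + (p + q) + M"
    and I: "I = (monomial_ideal (\<alpha> + q + M) (\<beta> + p + M) c \<alpha> \<beta> (p + q) :: (xyz, 'k) mpoly set)"
  shows "weak_Lefschetz (mpoly_ring Quot I) (quot_component I)"
  unfolding I monomial_ideal_eq_supported
proof (rule weak_LefschetzI[where l = ell])
  show "ideal (supported (ideal_exponents (\<alpha> + q + M) (\<beta> + p + M) c \<alpha> \<beta> (p + q)))
      (mpoly_ring :: (xyz, 'k) mpoly ring)"
    by (rule ideal_supported) (rule ideal_exponents_up)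
  fix d :: int
  show "(\<forall>f\<in>poly_component d. ell * f \<in> supported (ideal_exponents (\<alpha> + q + M) (\<beta> + p + M) c \<alpha> \<beta> (p + q))
      \<longrightarrow> (f :: (xyz, 'k) mpoly) \<in> supported (ideal_exponents (\<alpha> + q + M) (\<beta> + p + M) c \<alpha> \<beta> (p + q))) \<or>
    (\<forall>f\<in>poly_component (d + 1). \<exists>g\<in>poly_component d. (f :: (xyz, 'k) mpoly) - ell * g
      \<in> supported (ideal_exponents (\<alpha> + q + M) (\<beta> + p + M) c \<alpha> \<beta> (p + q)))"
  proof (cases "d + 1 < int c")
    case True
    then show ?thesis using ell_injective[OF det c] by blast
  next
    case False
    then show ?thesis using ell_surjective[OF det c] by simp
  qed
qed (use component_mult[OF ell_in_component] in \<open>simp_all add: ell_in_component component_diff add.commute\<close>)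

text \<open>
  The entries \<open>(\<gamma> choose p + j - i)\<close> are rewritten by the symmetry of binomial coefficients.
\<close>

lemma N_mat_eq_binom_toeplitz:
  fixes a b c \<alpha> \<beta> \<gamma> :: int
  assumes "2 * c = a + b + \<alpha> + \<beta> + \<gamma>" and \<gamma>: "\<gamma> = int (p + q)"
    and M: "c - (\<alpha> + \<beta> + \<gamma>) = int M" and p: "c - a - \<beta> = int p"
  shows "N_mat a b c \<alpha> \<beta> \<gamma> = binom_toeplitz M (p + q) q"
proof -
  have s: "(a + b + c + \<alpha> + \<beta> + \<gamma>) div 3 = c" using assms(1) by simp
  have entry: "binom_int \<gamma> (int p + int j - int i) =
      (if j \<le> q + i then int ((p + q) choose (q + i - j)) else 0)" for i j
  proof (cases "j \<le> q + i \<and> i \<le> p + j")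
    case True
    have "nat (int p + int j - int i) = p + j - i" by auto
    moreover have "(p + q) choose (p + j - i) = (p + q) choose (q + i - j)"
      using True binomial_symmetric[of "p + j - i" "p + q"] by auto
    ultimately show ?thesis using True unfolding binom_int_def \<gamma> nat_int by auto
  qed (auto simp: binom_int_def \<gamma> binomial_eq_0)
  have "c - a - \<beta> + (int j + 1) - (int i + 1) = int p + int j - int i" for i j using p by simp
  then show ?thesis
    unfolding N_mat_def Let_def s
    using M entry p
    by (intro eq_matI) (simp_all add: binom_toeplitz_def algebra_simps)
qed

theorem proposition6p6:
  fixes a b c \<alpha> \<beta> \<gamma> s A B C M :: int
  fixes I :: "(xyz, 'k::field) mpoly set"
  assumes "0 \<le> \<alpha>" "\<alpha> < a" "0 \<le> \<beta>" "\<beta> < b" "0 \<le> \<gamma>" "\<gamma> < c"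
    and "\<not> (\<alpha> = 0 \<and> \<beta> = 0)" "\<not> (\<alpha> = 0 \<and> \<gamma> = 0)" "\<not> (\<beta> = 0 \<and> \<gamma> = 0)"
    and "3 dvd a + b + c + \<alpha> + \<beta> + \<gamma>"
    and "s = (a + b + c + \<alpha> + \<beta> + \<gamma>) div 3 - 2"
    and "A = s + 2 - a" "B = s + 2 - b" "C = s + 2 - c" "M = s + 2 - (\<alpha> + \<beta> + \<gamma>)"
    and "0 \<le> M" "0 \<le> A" "A \<le> \<beta> + \<gamma>" "0 \<le> B" "B \<le> \<alpha> + \<gamma>" "0 \<le> C" "C \<le> \<alpha> + \<beta>"
    and "2 * c = a + b + \<alpha> + \<beta> + \<gamma>"
    and "I = monomial_ideal (nat a) (nat b) (nat c) (nat \<alpha>) (nat \<beta>) (nat \<gamma>)"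
  shows "C = 0
    \<and> 0 \<le> A - \<beta> \<and> 0 \<le> B - \<alpha>
    \<and> rat_of_int (det (N_mat a b c \<alpha> \<beta> \<gamma>)) = Mac (nat M) (nat (A - \<beta>)) (nat (B - \<alpha>))
    \<and> A + B + M - \<alpha> - \<beta> = c - \<alpha> - \<beta>
    \<and> (infinite (UNIV :: 'k set) \<longrightarrow>
         CHAR('k) = 0 \<or> int CHAR('k) \<ge> A + B + M - \<alpha> - \<beta> \<longrightarrow>
         weak_Lefschetz (mpoly_ring Quot I) (quot_component I))"
proof -
  have s: "s = c - 2" using assms(11,23) by simp
  define p q m where "p = nat (A - \<beta>)" and "q = nat (B - \<alpha>)" and "m = nat M"
  have C: "C = 0" and pq: "0 \<le> A - \<beta>" "0 \<le> B - \<alpha>" and sum: "A + B + M - \<alpha> - \<beta> = c - \<alpha> - \<beta>"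
    using assms s by linarith+
  have int_pq: "int p = A - \<beta>" "int q = B - \<alpha>" "int m = M"
    using pq assms(16) by (simp_all add: p_def q_def m_def)
  have \<gamma>: "\<gamma> = int (p + q)" using assms s by (simp add: int_pq)
  have N: "N_mat a b c \<alpha> \<beta> \<gamma> = binom_toeplitz m (p + q) q"
    by (rule N_mat_eq_binom_toeplitz[OF assms(23) \<gamma>]) (use assms s int_pq in auto)
  have "rat_of_int (det (N_mat a b c \<alpha> \<beta> \<gamma>)) = Mac m p q"
    using det_binom_toeplitz[of m p q, THEN arg_cong[where f = rat_of_int]]
      hyperfact_pos[of "m + p"] hyperfact_pos[of "m + q"] hyperfact_pos[of "p + q"]
    unfolding Mac_def N by (simp add: eq_divide_eq)
  moreover have "weak_Lefschetz (mpoly_ring Quot I) (quot_component I)"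
    if "CHAR('k) = 0 \<or> int CHAR('k) \<ge> A + B + M - \<alpha> - \<beta>"
  proof (rule weak_Lefschetz_monomial_ideal)
    show "det (binom_toeplitz m (p + q) q :: 'k mat) \<noteq> 0"
      by (rule det_binom_toeplitz_nonzero) (use that int_pq in linarith)
    show "nat c = nat \<alpha> + nat \<beta> + (p + q) + m" using int_pq assms s by linarith
    have "nat a = nat \<alpha> + q + m" "nat b = nat \<beta> + p + m" "nat \<gamma> = p + q"
      using int_pq \<gamma> assms s by linarith+
    then show "I = monomial_ideal (nat \<alpha> + q + m) (nat \<beta> + p + m) (nat c) (nat \<alpha>) (nat \<beta>) (p + q)"
      using assms(24) by simp
  qed
  ultimately show ?thesis using C pq sum by (simp add: p_def q_def m_def)
qed

end
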